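(* The space $\mathcal G^{\mathbb R}_{4,2}$ is homeomorphic to (the topological realization of) the graph with the twelve vertices $v_1,\dots,v_{12}$ and the following twenty-four edges, namely the edges of the six 4-cycles $$\begin{aligned}&v_1-v_3-v_5-v_7-v_1,\qquad v_2-v_4-v_6-v_8-v_2,\\ &v_9-v_3-v_{11}-v_7-v_9,\qquad v_{10}-v_4-v_{12}-v_8-v_{10},\\ &v_9-v_6-v_{11}-v_2-v_9,\qquad v_{10}-v_1-v_{12}-v_5-v_{10}.\end{aligned}$$
   Context: $\mathcal G^{\mathbb R}_{4,2}=\{2P\mid P\in M_4(\mathbb R)$ a projection (self-adjoint idempotent) of rank $2$, $P_{ii}=\frac12$ for $1\le i\le4\}$, with the relative topology from $M_4(\mathbb R)$; equivalently, it is the space of orbits under left multiplication by the $2\times 2$ orthogonal group of the space of spherical tight frames of four vectors in $\mathbb R^2$ (lists $(f_1,\dots,f_4)$ of unit vectors in $\mathbb R^2$ with $\sum_i|\langle v,f_i\rangle|^2=B\|v\|^2$ for all $v\in\mathbb R^2$ and some $B>0$). *)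

theory Defs
  imports "HOL-Analysis.Analysis"
begin

definition frame_space :: "(real^4^4) set" where
  "frame_space =
     {2 *\<^sub>R P | P. transpose P = P \<and> P ** P = P \<and> rank P = 2 \<and> (\<forall>i. P $ i $ i = 1/2)}"

text \<open>
  Topological realization of a finite simple graph whose vertex set is the whole type, given by its
  edges as two-element sets. Vertices go to the standard basis vectors and an edge to the segment
  joining its two end points. These segments meet only in common end points, so the subspace
  topology is the one obtained by gluing intervals along the vertices.
\<close>
definition realization :: "'v::finite set set \<Rightarrow> (real^'v) set" where
  "realization E =
     range (\<lambda>v. axis v 1) \<union> (\<Union>e\<in>E. convex hull ((\<lambda>v. axis v 1) ` e))"

datatype vertex = v1 | v2 | v3 | v4 | v5 | v6 | v7 | v8 | v9 | v10 | v11 | v12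

lemma UNIV_vertex: "UNIV = {v1, v2, v3, v4, v5, v6, v7, v8, v9, v10, v11, v12}"
  using vertex.exhaust by auto

instance vertex :: finite
  by standard (simp add: UNIV_vertex)

definition cycle4 :: "'v \<Rightarrow> 'v \<Rightarrow> 'v \<Rightarrow> 'v \<Rightarrow> 'v set set" where
  "cycle4 a b c d = {{a, b}, {b, c}, {c, d}, {d, a}}"

definition frame_graph :: "vertex set set" where
  "frame_graph =
     cycle4 v1 v3 v5 v7 \<union> cycle4 v2 v4 v6 v8 \<union>
     cycle4 v9 v3 v11 v7 \<union> cycle4 v10 v4 v12 v8 \<union>
     cycle4 v9 v6 v11 v2 \<union> cycle4 v10 v1 v12 v5"

lemma card_vertex: "CARD(vertex) = 12"
  by (simp add: UNIV_vertex)

lemma frame_graph_simple: "e \<in> frame_graph \<Longrightarrow> card e = 2"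
  unfolding frame_graph_def cycle4_def by auto

lemma card_frame_graph: "card frame_graph = 24"
  unfolding frame_graph_def cycle4_def by (simp add: doubleton_eq_iff card_insert_if)

end

theory Submission
  imports Defs
begin

text \<open>
  A point of the space is the Gram matrix \<open>G\<close> of four unit vectors in the plane. In the off-diagonal
  entries, grouped by the three ways of splitting \<open>{1,2,3,4}\<close> into two pairs,
  \<open>a, a' = G 1 2, G 3 4\<close>, \<open>b, b' = G 1 3, G 2 4\<close> and \<open>c, c' = G 1 4, G 2 3\<close>, the equation
  \<open>G\<^sup>2 = 2G\<close> says that \<open>\<bar>a\<bar> = \<bar>a'\<bar>\<close>, \<open>\<bar>b\<bar> = \<bar>b'\<bar>\<close>, \<open>\<bar>c\<bar> = \<bar>c'\<bar>\<close>, \<open>a\<^sup>2 + b\<^sup>2 + c\<^sup>2 = 1\<close> and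
  \<open>a b' = - a' b\<close>, \<open>a c' = - a' c\<close>, \<open>b c' = - b' c\<close>. If none of \<open>a, b, c\<close> vanished, the three signs
  relating \<open>a'\<close> to \<open>a\<close>, \<open>b'\<close> to \<open>b\<close> and \<open>c'\<close> to \<open>c\<close> would be pairwise different, which is
  impossible. So one pair vanishes, the other two are related by opposite signs, and the space is a
  union of six circles (\<open>tight_cases\<close>). The rank condition is automatic, as the rank of an
  orthogonal projection is its trace (\<open>rank_orthogonal_projection\<close>).

  The twelve vertices are the matrices in which exactly one pair is nonzero, with entries \<open>\<plusminus>1\<close>.
  For the splitting with entries \<open>x, x'\<close>, the vertex with signs \<open>\<sigma>, \<tau>\<close> receives the barycentric
  coordinate \<open>max 0 (\<sigma> x) * max 0 (\<tau> x')\<close>. Since \<open>\<bar>x\<bar> = \<bar>x'\<bar>\<close>, only the vertex whose signs are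
  those of \<open>x\<close> and \<open>x'\<close> can have a nonzero coordinate, namely \<open>x\<^sup>2\<close>; on each circle this leaves two
  adjacent vertices with weights adding up to 1. Thus each circle is mapped onto one of the six
  4-cycles. Conversely, the coordinates added with signs \<open>\<sigma>\<close> or \<open>\<tau>\<close> give \<open>x \<bar>x\<bar>\<close> or \<open>x' \<bar>x'\<bar>\<close>,
  and the odd square root recovers \<open>x\<close> and \<open>x'\<close> continuously. The two maps \<open>to_graph\<close> and
  \<open>of_graph\<close> are mutually inverse homeomorphisms.
\<close>

section \<open>The frame space as a set of Gram matrices\<close>

text \<open>
  Expand \<open>P\<close> in an orthonormal basis \<open>B\<close> of its range: \<open>P\<close> is the sum of the matrices \<open>b b\<^sup>T\<close>,
  each of trace 1.
\<close>
lemma rank_orthogonal_projection: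
  fixes P :: "real^'n^'n"
  assumes sym: "transpose P = P" and idem: "P ** P = P"
  shows "real (rank P) = (\<Sum>i\<in>UNIV. P $ i $ i)"
proof -
  let ?V = "range ((*v) P)"
  have fixP: "P *v x = x" if "x \<in> ?V" for x
    using that idem by (auto simp: matrix_vector_mul_assoc)
  have "subspace ?V"
    by (intro linear_subspace_image matrix_vector_mul_linear subspace_UNIV)
  then have "\<exists>B \<subseteq> ?V. pairwise orthogonal B \<and> (\<forall>x\<in>B. norm x = 1) \<and> card B = dim ?V \<and> span B = ?V"
    by (rule orthonormal_basis_subspace) blast
  then obtain B where B: "B \<subseteq> ?V" "pairwise orthogonal B" "\<forall>x\<in>B. norm x = 1"
      "card B = dim ?V" "span B = ?V"
    by blast
  have expand: "P *v x = (\<Sum>b\<in>B. (b \<bullet> x) *\<^sub>R b)" for x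
  proof -
    let ?s = "\<Sum>b\<in>B. (b \<bullet> (P *v x) / (b \<bullet> b)) *\<^sub>R b"
    have "P *v x - ?s \<in> span B"
    proof (intro span_diff span_sum span_scale)
      show "P *v x \<in> span B" by (simp add: B(5))
    qed (rule span_base)
    then have "P *v x = ?s"
      using Gram_Schmidt_step[OF B(2), of "P *v x - ?s" "P *v x"] by (simp only: orthogonal_self right_minus_eq)
    also have "\<dots> = (\<Sum>b\<in>B. (b \<bullet> x) *\<^sub>R b)"
    proof (rule sum.cong[OF refl])
      fix b assume b: "b \<in> B"
      have "b \<bullet> (P *v x) = (P *v b) \<bullet> x"
        using dot_lmul_matrix[of b P x] vector_transpose_matrix[of b P] by (simp only: sym)
      also have "P *v b = b" using b B(1) by (intro fixP) blast
      finally show "(b \<bullet> (P *v x) / (b \<bullet> b)) *\<^sub>R b = (b \<bullet> x) *\<^sub>R b"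
        using B(3) b by (simp add: norm_eq_1)
    qed
    finally show ?thesis .
  qed
  have diag: "P $ i $ i = (\<Sum>b\<in>B. b $ i * b $ i)" for i
  proof -
    have "P $ i $ i = (P *v axis i 1) $ i"
      by (simp only: matrix_vector_mult_basis column_def vec_lambda_beta)
    then show ?thesis
      unfolding expand by (simp add: inner_axis)
  qed
  have "(\<Sum>i\<in>UNIV. P $ i $ i) = (\<Sum>b\<in>B. b \<bullet> b)"
    unfolding diag inner_vec_def inner_real_def by (rule sum.swap)
  also have "\<dots> = real (card B)"
    using B(3) by (simp add: norm_eq_1)
  finally show ?thesis
    by (simp only: B(4) rank_dim_range)
qed

lemma mem_frame_space_iff:
  "G \<in> frame_space \<longleftrightarrow> transpose G = G \<and> G ** G = 2 *\<^sub>R G \<and> (\<forall>i. G $ i $ i = 1)"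
proof
  assume "G \<in> frame_space"
  then obtain P where "G = 2 *\<^sub>R P" "transpose P = P" "P ** P = P" and diag: "\<forall>i. P $ i $ i = 1/2"
    by (auto simp: frame_space_def)
  then have "transpose G = G" "G ** G = 2 *\<^sub>R G"
    by (simp_all add: transpose_scalar matrix_scalar_ac flip: scalar_matrix_assoc)
  moreover have "G $ i $ i = 1" for i
    using diag[rule_format, of i] \<open>G = 2 *\<^sub>R P\<close> by simp
  ultimately show "transpose G = G \<and> G ** G = 2 *\<^sub>R G \<and> (\<forall>i. G $ i $ i = 1)"
    by blast
next
  assume G: "transpose G = G \<and> G ** G = 2 *\<^sub>R G \<and> (\<forall>i. G $ i $ i = 1)"
  define P where "P = (1/2) *\<^sub>R G"
  have P: "transpose P = P" "P ** P = P" "\<forall>i. P $ i $ i = 1/2" "G = 2 *\<^sub>R P"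
    using G by (auto simp: P_def transpose_scalar matrix_scalar_ac simp flip: scalar_matrix_assoc)
  have "real (rank P) = 2"
    unfolding rank_orthogonal_projection[OF P(1,2)] using P(3) by (simp only: sum_4)
  then show "G \<in> frame_space"
    using P by (auto simp: frame_space_def)
qed

text \<open>
  The symmetric matrix with unit diagonal and off-diagonal entries \<open>a, a'\<close> at \<open>(1,2), (3,4)\<close>,
  \<open>b, b'\<close> at \<open>(1,3), (2,4)\<close> and \<open>c, c'\<close> at \<open>(1,4), (2,3)\<close>: a primed entry sits at the pair
  complementary to that of the unprimed one.
\<close>
definition gram :: "real \<Rightarrow> real \<Rightarrow> real \<Rightarrow> real \<Rightarrow> real \<Rightarrow> real \<Rightarrow> real^4^4" where
  "gram a a' b b' c c' =
     vector [vector [1, a, b, c], vector [a, 1, c', b'],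
             vector [b, c', 1, a'], vector [c, b', a', 1]]"

text \<open>
  The equation \<open>G\<^sup>2 = 2G\<close> for \<open>G = gram a a' b b' c c'\<close>. Of its six off-diagonal entries only the
  three in the first row are listed; the others follow from these conditions.
\<close>
definition tight :: "real \<Rightarrow> real \<Rightarrow> real \<Rightarrow> real \<Rightarrow> real \<Rightarrow> real \<Rightarrow> bool" where
  "tight a a' b b' c c' \<longleftrightarrow>
     a\<^sup>2 = a'\<^sup>2 \<and> b\<^sup>2 = b'\<^sup>2 \<and> c\<^sup>2 = c'\<^sup>2 \<and> a\<^sup>2 + b\<^sup>2 + c\<^sup>2 = 1 \<and>
     a * b' = - (a' * b) \<and> a * c' = - (a' * c) \<and> b * c' = - (b' * c)"

lemma vector_4:
  "(vector [w, x, y, z] :: 'a::zero^4) $ 1 = w" "(vector [w, x, y, z] :: 'a::zero^4) $ 2 = x"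
  "(vector [w, x, y, z] :: 'a::zero^4) $ 3 = y" "(vector [w, x, y, z] :: 'a::zero^4) $ 4 = z"
  by (simp_all add: vector_def)

text \<open>The six circles: one complementary pair vanishes, and the other two have opposite relative signs.\<close>
lemma tight_cases:
  assumes "tight a a' b b' c c'"
  obtains "a = 0" "a' = 0" "b' = b" "c' = - c" "b\<^sup>2 + c\<^sup>2 = 1"
  | "a = 0" "a' = 0" "b' = - b" "c' = c" "b\<^sup>2 + c\<^sup>2 = 1"
  | "b = 0" "b' = 0" "a' = a" "c' = - c" "a\<^sup>2 + c\<^sup>2 = 1"
  | "b = 0" "b' = 0" "a' = - a" "c' = c" "a\<^sup>2 + c\<^sup>2 = 1"
  | "c = 0" "c' = 0" "a' = a" "b' = - b" "a\<^sup>2 + b\<^sup>2 = 1"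
  | "c = 0" "c' = 0" "a' = - a" "b' = b" "a\<^sup>2 + b\<^sup>2 = 1"
proof -
  have sq: "a' = a \<or> a' = - a" "b' = b \<or> b' = - b" "c' = c \<or> c' = - c"
    and one: "a\<^sup>2 + b\<^sup>2 + c\<^sup>2 = 1"
    and prod: "a * b' = - (a' * b)" "a * c' = - (a' * c)" "b * c' = - (b' * c)"
    using assms by (auto simp: tight_def power2_eq_iff)
  have opposite: "x' = x \<and> y' = - y \<or> x' = - x \<and> y' = y"
    if "x' = x \<or> x' = - x" "y' = y \<or> y' = - y" "x * y' = - (x' * y)" for x x' y y' :: real
    using that by (elim disjE; auto)
  have ab: "a' = a \<and> b' = - b \<or> a' = - a \<and> b' = b"
    and ac: "a' = a \<and> c' = - c \<or> a' = - a \<and> c' = c"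
    and bc: "b' = b \<and> c' = - c \<or> b' = - b \<and> c' = c"
    using opposite[OF sq(1,2) prod(1)] opposite[OF sq(1,3) prod(2)] opposite[OF sq(2,3) prod(3)]
    by auto
  \<comment> \<open>Three signs cannot be pairwise different.\<close>
  have "a = 0 \<or> b = 0 \<or> c = 0"
    using ab ac bc by linarith
  then show thesis
  proof (elim disjE)
    assume "a = 0"
    then have "a' = 0" "b\<^sup>2 + c\<^sup>2 = 1" using sq(1) one by auto
    then show thesis using bc that(1,2) \<open>a = 0\<close> by blast
  next
    assume "b = 0"
    then have "b' = 0" "a\<^sup>2 + c\<^sup>2 = 1" using sq(2) one by auto
    then show thesis using ac that(3,4) \<open>b = 0\<close> by blast
  next
    assume "c = 0"
    then have "c' = 0" "a\<^sup>2 + b\<^sup>2 = 1" using sq(3) one by auto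
    then show thesis using ab that(5,6) \<open>c = 0\<close> by blast
  qed
qed

lemma gram_in_frame_space:
  assumes "tight a a' b b' c c'"
  shows "gram a a' b b' c c' \<in> frame_space"
  using assms
  by (cases rule: tight_cases;
    simp add: mem_frame_space_iff gram_def vec_eq_iff forall_4 sum_4 vector_4
      transpose_def matrix_matrix_mult_def power2_eq_square algebra_simps)

lemma frame_space_gram:
  assumes "G \<in> frame_space"
  shows "G = gram (G$1$2) (G$3$4) (G$1$3) (G$2$4) (G$1$4) (G$2$3)"
    and "tight (G$1$2) (G$3$4) (G$1$3) (G$2$4) (G$1$4) (G$2$3)"
proof -
  from assms have *: "transpose G = G" "G ** G = 2 *\<^sub>R G" "\<forall>i. G $ i $ i = 1"
    by (auto simp: mem_frame_space_iff)
  have symm: "G $ i $ j = G $ j $ i" for i j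
    using arg_cong[OF *(1), of "\<lambda>A. A $ j $ i"] by (simp add: transpose_def)
  note sym = symm[of 2 1] symm[of 3 1] symm[of 4 1] symm[of 3 2] symm[of 4 2] symm[of 4 3]
  show "G = gram (G$1$2) (G$3$4) (G$1$3) (G$2$4) (G$1$4) (G$2$3)"
    using *(3) by (simp add: gram_def vec_eq_iff forall_4 vector_4 sym)
  have prod: "(\<Sum>k\<in>UNIV. G $ i $ k * G $ k $ j) = 2 * G $ i $ j" for i j
    using *(2) by (simp add: vec_eq_iff matrix_matrix_mult_def)
  have row: "G$1$2 * G$1$2 + G$1$3 * G$1$3 + G$1$4 * G$1$4 = 1"
    "G$1$2 * G$1$2 + G$2$3 * G$2$3 + G$2$4 * G$2$4 = 1"
    "G$1$3 * G$1$3 + G$2$3 * G$2$3 + G$3$4 * G$3$4 = 1"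
    "G$1$4 * G$1$4 + G$2$4 * G$2$4 + G$3$4 * G$3$4 = 1"
    using prod[of 1 1] prod[of 2 2] prod[of 3 3] prod[of 4 4] *(3) by (simp_all add: sum_4 sym)
  have "G$1$3 * G$2$3 + G$1$4 * G$2$4 = 0" "G$1$2 * G$2$3 + G$1$4 * G$3$4 = 0"
    "G$1$2 * G$2$4 + G$1$3 * G$3$4 = 0"
    using prod[of 1 2] prod[of 1 3] prod[of 1 4] *(3) by (simp_all add: sum_4 sym)
  then have "G$1$2 * G$2$4 = - (G$3$4 * G$1$3)" "G$1$2 * G$2$3 = - (G$3$4 * G$1$4)"
    "G$1$3 * G$2$3 = - (G$2$4 * G$1$4)"
    by (simp_all add: add_eq_0_iff2 mult.commute)
  moreover have "(G$1$2)\<^sup>2 = (G$3$4)\<^sup>2" "(G$1$3)\<^sup>2 = (G$2$4)\<^sup>2" "(G$1$4)\<^sup>2 = (G$2$3)\<^sup>2"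
    "(G$1$2)\<^sup>2 + (G$1$3)\<^sup>2 + (G$1$4)\<^sup>2 = 1"
    using row unfolding power2_eq_square by linarith+
  ultimately show "tight (G$1$2) (G$3$4) (G$1$3) (G$2$4) (G$1$4) (G$2$3)"
    unfolding tight_def by blast
qed

section \<open>The two maps\<close>

text \<open>The positive part of a real number.\<close>
definition pos :: "real \<Rightarrow> real" where
  "pos x = max 0 x"

lemma pos_0: "pos 0 = 0"
  by (simp add: pos_def)

lemma pos_mult_pos_minus: "pos x * pos (- x) = 0" "pos (- x) * pos x = 0"
  by (simp_all add: pos_def max_def)

lemma pos_cases:
  obtains "pos x * pos x = x\<^sup>2" "pos (- x) = 0" | "pos x = 0" "pos (- x) * pos (- x) = x\<^sup>2"
  by (cases "0 \<le> x") (auto simp: pos_def power2_eq_square)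

text \<open>
  Barycentric coordinates of a matrix. The pairs of opposite signs in each splitting are the pairs of
  opposite vertices in the 4-cycles: \<open>v9, v11\<close> and \<open>v10, v12\<close> for \<open>12|34\<close>, \<open>v1, v5\<close> and \<open>v2, v6\<close> for
  \<open>13|24\<close>, \<open>v4, v8\<close> and \<open>v3, v7\<close> for \<open>14|23\<close>; the first-named pair has equal signs, the second one
  different signs. This labelling makes every circle of \<open>tight_cases\<close> run through one of the six
  prescribed 4-cycles.
\<close>
primrec wt :: "real^4^4 \<Rightarrow> vertex \<Rightarrow> real" where
  "wt G v1 = pos (G$1$3) * pos (G$2$4)"
| "wt G v2 = pos (G$1$3) * pos (- G$2$4)"
| "wt G v3 = pos (G$1$4) * pos (- G$2$3)"
| "wt G v4 = pos (G$1$4) * pos (G$2$3)"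
| "wt G v5 = pos (- G$1$3) * pos (- G$2$4)"
| "wt G v6 = pos (- G$1$3) * pos (G$2$4)"
| "wt G v7 = pos (- G$1$4) * pos (G$2$3)"
| "wt G v8 = pos (- G$1$4) * pos (- G$2$3)"
| "wt G v9 = pos (G$1$2) * pos (G$3$4)"
| "wt G v10 = pos (G$1$2) * pos (- G$3$4)"
| "wt G v11 = pos (- G$1$2) * pos (- G$3$4)"
| "wt G v12 = pos (- G$1$2) * pos (G$3$4)"

text \<open>The map to the graph, given by the barycentric coordinates.\<close>
definition to_graph :: "real^4^4 \<Rightarrow> real^vertex" where
  "to_graph G = (\<chi> v. wt G v)"

text \<open>
  The inverse map. It uses that \<open>sqrt\<close> is odd, \<open>sqrt (- x) = - sqrt x\<close>, and continuous on the whole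
  real line.
\<close>
definition of_graph :: "real^vertex \<Rightarrow> real^4^4" where
  "of_graph x =
     gram (sqrt (x$v9 + x$v10 - x$v11 - x$v12)) (sqrt (x$v9 - x$v10 - x$v11 + x$v12))
          (sqrt (x$v1 + x$v2 - x$v5 - x$v6)) (sqrt (x$v1 - x$v2 - x$v5 + x$v6))
          (sqrt (x$v4 + x$v3 - x$v8 - x$v7)) (sqrt (x$v4 - x$v3 - x$v8 + x$v7))"

lemma continuous_to_graph: "continuous_on S to_graph"
proof -
  have "continuous_on S (\<lambda>G. wt G v)" for v
    by (cases v; simp add: pos_def; intro continuous_intros)
  then show ?thesis
    unfolding to_graph_def by (intro continuous_on_vec_lambda)
qed

lemma continuous_of_graph: "continuous_on S of_graph"
proof -
  have "continuous_on S (\<lambda>x. of_graph x $ i $ j)" for i j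
    using exhaust_4[of i] exhaust_4[of j]
    by (elim disjE; simp add: of_graph_def gram_def vector_4; intro continuous_intros)
  then have "continuous_on S (\<lambda>x. \<chi> i j. of_graph x $ i $ j)"
    by (intro continuous_on_vec_lambda)
  then show ?thesis by simp
qed

section \<open>Points of the graph\<close>

lemma all_vertex:
  "(\<forall>v. Q v) \<longleftrightarrow> Q v1 \<and> Q v2 \<and> Q v3 \<and> Q v4 \<and> Q v5 \<and> Q v6 \<and>
     Q v7 \<and> Q v8 \<and> Q v9 \<and> Q v10 \<and> Q v11 \<and> Q v12"
proof -
  have "(\<forall>v. Q v) \<longleftrightarrow> (\<forall>v\<in>UNIV. Q v)"
    by simp
  then show ?thesis
    by (simp only: UNIV_vertex ball_simps simp_thms)
qed

text \<open>
  The edges with a chosen orientation. Each 4-cycle is the complete bipartite graph between its two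
  pairs of opposite vertices.
\<close>
definition edge_pairs :: "(vertex \<times> vertex) set" where
  "edge_pairs = {v1, v5} \<times> {v3, v7} \<union> {v2, v6} \<times> {v4, v8} \<union>
     {v9, v11} \<times> {v3, v7} \<union> {v10, v12} \<times> {v4, v8} \<union>
     {v9, v11} \<times> {v2, v6} \<union> {v10, v12} \<times> {v1, v5}"

lemma frame_graph_eq: "frame_graph = (\<lambda>(v, w). {v, w}) ` edge_pairs"
  by (simp add: frame_graph_def cycle4_def edge_pairs_def image_Un Sigma_def insert_commute Un_ac)

lemma realization_edgeI:
  assumes "{v, w} \<in> E" "0 \<le> s" "0 \<le> t" "s + t = 1"
  shows "s *\<^sub>R axis v 1 + t *\<^sub>R axis w 1 \<in> realization E"
  using assms unfolding realization_def by (force simp: convex_hull_2)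

lemma axis_nth_if: "axis v x $ w = (if w = v then x else 0)"
  by (simp add: axis_def)

lemma realization_frame_graphE:
  assumes "x \<in> realization frame_graph"
  obtains v w s t where "(v, w) \<in> edge_pairs" "0 \<le> s" "0 \<le> t" "s + t = 1"
    "x = s *\<^sub>R axis v 1 + t *\<^sub>R axis w 1"
proof -
  have axis: "\<exists>w. (v, w) \<in> edge_pairs \<or> (w, v) \<in> edge_pairs" for v
    by (cases v; auto simp: edge_pairs_def)
  from assms consider v where "x = axis v 1" |
    v w where "(v, w) \<in> edge_pairs" "x \<in> convex hull ((\<lambda>v. axis v 1) ` {v, w})"
    by (auto simp: realization_def frame_graph_eq)
  then show thesis
  proof cases
    \<comment> \<open>No vertex is isolated, so a vertex is an end point of an edge.\<close>
    case (1 v)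
    then show thesis using axis[of v] that[of v _ 1 0] that[of _ v 0 1] by auto
  next
    case (2 v w)
    then show thesis using that by (auto simp: convex_hull_2)
  qed
qed

section \<open>The maps are mutually inverse\<close>

lemma of_to_graph:
  assumes "G \<in> frame_space"
  shows "of_graph (to_graph G) = G"
proof -
  \<comment> \<open>The signed sums are \<open>x * \<bar>y\<bar> = x * \<bar>x\<bar>\<close> and \<open>\<bar>x\<bar> * y = y * \<bar>y\<bar>\<close>.\<close>
  have *: "sqrt (pos x * pos y + pos x * pos (-y) - pos (-x) * pos (-y) - pos (-x) * pos y) = x"
          "sqrt (pos x * pos y - pos x * pos (-y) - pos (-x) * pos (-y) + pos (-x) * pos y) = y"
    if "x\<^sup>2 = y\<^sup>2" for x y
  proof -
    have "y = x \<or> y = - x" using that by (auto simp: power2_eq_iff)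
    then show "sqrt (pos x * pos y + pos x * pos (-y) - pos (-x) * pos (-y) - pos (-x) * pos y) = x"
          "sqrt (pos x * pos y - pos x * pos (-y) - pos (-x) * pos (-y) + pos (-x) * pos y) = y"
      by (cases "x \<ge> 0"; auto simp: pos_def max_def real_sqrt_minus real_sqrt_mult_self)+
  qed
  from frame_space_gram(2)[OF assms] show ?thesis
    by (subst (2) frame_space_gram(1)[OF assms]) (simp add: of_graph_def to_graph_def tight_def *)
qed

lemma of_graph_in_frame_space:
  assumes "x \<in> realization frame_graph"
  shows "of_graph x \<in> frame_space"
proof -
  obtain v w s t where edge: "(v, w) \<in> edge_pairs" and st: "0 \<le> s" "0 \<le> t" "s + t = 1"
    and x: "x = s *\<^sub>R axis v 1 + t *\<^sub>R axis w 1"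
    using assms by (rule realization_frame_graphE)
  have x_nth: "x $ u = (if u = v then s else 0) + (if u = w then t else 0)" for u
    by (simp add: x axis_nth_if)
  show ?thesis
    unfolding of_graph_def
  proof (rule gram_in_frame_space)
    show "tight (sqrt (x$v9 + x$v10 - x$v11 - x$v12)) (sqrt (x$v9 - x$v10 - x$v11 + x$v12))
        (sqrt (x$v1 + x$v2 - x$v5 - x$v6)) (sqrt (x$v1 - x$v2 - x$v5 + x$v6))
        (sqrt (x$v4 + x$v3 - x$v8 - x$v7)) (sqrt (x$v4 - x$v3 - x$v8 + x$v7))"
      using edge st unfolding edge_pairs_def x_nth
      by (elim UnE SigmaE2 insertE emptyE; simp add: tight_def real_sqrt_minus)
  qed
qed

lemma to_of_graph:
  assumes "x \<in> realization frame_graph"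
  shows "to_graph (of_graph x) = x"
proof -
  obtain v w s t where edge: "(v, w) \<in> edge_pairs" and st: "0 \<le> s" "0 \<le> t"
    and x: "x = s *\<^sub>R axis v 1 + t *\<^sub>R axis w 1"
    using assms by (rule realization_frame_graphE)
  have x_nth: "x $ u = (if u = v then s else 0) + (if u = w then t else 0)" for u
    by (simp add: x axis_nth_if)
  have *: "pos 0 = 0" "pos (sqrt r) = sqrt r" "pos (- sqrt r) = 0" "sqrt r * sqrt r = r"
    if "0 \<le> r" for r
    using that by (simp_all add: pos_def)
  note st[THEN *(2)] st[THEN *(3)] st[THEN *(4)]
  note pos_sqrt = this *(1)[OF order_refl]
  have "\<forall>u. wt (of_graph x) u = x $ u"
    using edge unfolding edge_pairs_def of_graph_def gram_def vector_4 wt.simps all_vertex x_nth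
    by (elim UnE SigmaE2 insertE emptyE;
        simp only: vertex.distinct if_True if_False simp_thms add_0_left add_0_right diff_0 diff_0_right
          minus_minus minus_zero real_sqrt_zero real_sqrt_minus pos_sqrt mult_zero_left mult_zero_right)
  then show ?thesis
    by (simp add: to_graph_def vec_eq_iff)
qed

lemma to_graph_in_realization:
  assumes "G \<in> frame_space"
  shows "to_graph G \<in> realization frame_graph"
proof -
  have edge: "to_graph G \<in> realization frame_graph"
    if "(v, w) \<in> edge_pairs" "s + t = 1" "0 \<le> s" "0 \<le> t"
      "\<And>u. wt G u = (if u = v then s else 0) + (if u = w then t else 0)" for v w s t
  proof -
    have "{v, w} \<in> frame_graph"
      using imageI[OF that(1), of "\<lambda>(v, w). {v, w}"] by (simp add: frame_graph_eq)
    moreover have "to_graph G = s *\<^sub>R axis v 1 + t *\<^sub>R axis w 1"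
      unfolding to_graph_def vec_eq_iff by (simp add: that(5) axis_nth_if)
    ultimately show ?thesis
      using that(2-4) by (simp only: realization_edgeI)
  qed
  \<comment> \<open>A point of a circle lies on the edge of the 4-cycle picked out by the signs of its coordinates.\<close>
  have cycle: "to_graph G \<in> realization frame_graph"
    if sub: "{p, q} \<times> {r, t} \<subseteq> edge_pairs" and one: "x\<^sup>2 + y\<^sup>2 = 1"
      and wt: "\<forall>u. wt G u =
        (if u = p then pos x * pos x else 0) + (if u = q then pos (- x) * pos (- x) else 0) +
        (if u = r then pos y * pos y else 0) + (if u = t then pos (- y) * pos (- y) else 0)"
    for p q r t x y
  proof -
    have "(p, r) \<in> edge_pairs" "(p, t) \<in> edge_pairs" "(q, r) \<in> edge_pairs" "(q, t) \<in> edge_pairs"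
      using sub by blast+
    note edges = this[THEN edge, OF one zero_le_power2 zero_le_power2]
    show ?thesis
    proof (cases rule: pos_cases[of x]; cases rule: pos_cases[of y])
      assume "pos x * pos x = x\<^sup>2" "pos (- x) = 0" "pos y * pos y = y\<^sup>2" "pos (- y) = 0"
      then show ?thesis
        by (intro edges(1)) (simp only: wt mult_zero_left if_cancel add_0_left add_0_right)
    next
      assume "pos x * pos x = x\<^sup>2" "pos (- x) = 0" "pos y = 0" "pos (- y) * pos (- y) = y\<^sup>2"
      then show ?thesis
        by (intro edges(2)) (simp only: wt mult_zero_left if_cancel add_0_left add_0_right)
    next
      assume "pos x = 0" "pos (- x) * pos (- x) = x\<^sup>2" "pos y * pos y = y\<^sup>2" "pos (- y) = 0"
      then show ?thesis
        by (intro edges(3)) (simp only: wt mult_zero_left if_cancel add_0_left add_0_right)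
    next
      assume "pos x = 0" "pos (- x) * pos (- x) = x\<^sup>2" "pos y = 0" "pos (- y) * pos (- y) = y\<^sup>2"
      then show ?thesis
        by (intro edges(4)) (simp only: wt mult_zero_left if_cancel add_0_left add_0_right)
    qed
  qed
  show ?thesis
    using frame_space_gram(2)[OF assms]
  proof (cases rule: tight_cases)
    case 1
    then show ?thesis
      by (intro cycle[of v1 v5 v3 v7 "G$1$3" "G$1$4"];
        simp add: edge_pairs_def all_vertex pos_0 pos_mult_pos_minus)
  next
    case 2
    then show ?thesis
      by (intro cycle[of v2 v6 v4 v8 "G$1$3" "G$1$4"];
        simp add: edge_pairs_def all_vertex pos_0 pos_mult_pos_minus)
  next
    case 3
    then show ?thesis
      by (intro cycle[of v9 v11 v3 v7 "G$1$2" "G$1$4"];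
        simp add: edge_pairs_def all_vertex pos_0 pos_mult_pos_minus)
  next
    case 4
    then show ?thesis
      by (intro cycle[of v10 v12 v4 v8 "G$1$2" "G$1$4"];
        simp add: edge_pairs_def all_vertex pos_0 pos_mult_pos_minus)
  next
    case 5
    then show ?thesis
      by (intro cycle[of v9 v11 v2 v6 "G$1$2" "G$1$3"];
        simp add: edge_pairs_def all_vertex pos_0 pos_mult_pos_minus)
  next
    case 6
    then show ?thesis
      by (intro cycle[of v10 v12 v1 v5 "G$1$2" "G$1$3"];
        simp add: edge_pairs_def all_vertex pos_0 pos_mult_pos_minus)
  qed
qed

theorem theorem5p3: "frame_space homeomorphic realization frame_graph"
proof (rule homeomorphicI)
  show "to_graph ` frame_space = realization frame_graph"
  proof
    show "to_graph ` frame_space \<subseteq> realization frame_graph"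
      using to_graph_in_realization by blast
    show "realization frame_graph \<subseteq> to_graph ` frame_space"
    proof
      fix x assume x: "x \<in> realization frame_graph"
      show "x \<in> to_graph ` frame_space"
        using to_of_graph[OF x] of_graph_in_frame_space[OF x] by (metis imageI)
    qed
  qed
  show "of_graph ` realization frame_graph = frame_space"
  proof
    show "of_graph ` realization frame_graph \<subseteq> frame_space"
      using of_graph_in_frame_space by blast
    show "frame_space \<subseteq> of_graph ` realization frame_graph"
    proof
      fix G assume G: "G \<in> frame_space"
      show "G \<in> of_graph ` realization frame_graph"
        using of_to_graph[OF G] to_graph_in_realization[OF G] by (metis imageI)
    qed
  qed
qed (simp_all add: of_to_graph to_of_graph continuous_to_graph continuous_of_graph)

end
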